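(* Let $K\subset\mathbb{R}^n$ be a convex body, fix $\nu\in\mathbb{S}^{n-1}$, and let $h_\nu$ be the slicing support function of $K$. Then for every $u\in\nu^\perp$ and $\lambda\in\mathbb{R}$, $$h_K(u+\lambda\nu)=\sup_{p\in\mathbb{R}}\bigl(h_\nu(u,p)+\lambda p\bigr).$$ Consequently, knowing $h_\nu(u,p)$ for all $(u,p)\in\nu^\perp\times\mathbb{R}$ determines $h_K(v)$ for all $v\in\mathbb{R}^n$; more precisely, for all $v\in\mathbb{R}^n$, $$h_K(v)=\sup_{p\in\mathbb{R}}\Bigl(h_\nu\bigl(v-(v\cdot\nu)\nu,\,p\bigr)+(v\cdot\nu)\,p\Bigr).$$
   Context: For a convex body $K\subset\mathbb{R}^n$, the support function is $h_K(v)=\sup_{x\in K}x\cdot v$, $v\in\mathbb{R}^n$. For a unit vector $\nu\in\mathbb{S}^{n-1}$ write $\nu^\perp=\{x\in\mathbb{R}^n: x\cdot\nu=0\}$, and for $p\in\mathbb{R}$ let $C(\nu,p)=K\cap\{x\in\mathbb{R}^n: x\cdot\nu=p\}$ (possibly empty). The slicing support function is $h_\nu(u,p)=\sup_{x\in C(\nu,p)}x\cdot u$ for $u\in\nu^\perp$, $p\in\mathbb{R}$, with the convention $h_\nu(u,p)=-\infty$ if $C(\nu,p)=\emptyset$. *)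

theory Defs
  imports "HOL-Analysis.Analysis"
begin

text \<open>
  A convex body is a nonempty compact convex set. Nonempty interior is not required, so that
  results about \<^term>\<open>convex_body\<close> also cover the convention under which it is.
\<close>

definition convex_body :: "'a::euclidean_space set \<Rightarrow> bool" where
  "convex_body K \<longleftrightarrow> K \<noteq> {} \<and> compact K \<and> convex K"

text \<open>
  The supremum is taken in \<^typ>\<open>real\<close>; it is the true supremum whenever \<^term>\<open>K\<close> is nonempty and
  bounded, in particular for every convex body.
\<close>

definition support_fun :: "'a::euclidean_space set \<Rightarrow> 'a \<Rightarrow> real" where
  "support_fun K v = (SUP x\<in>K. x \<bullet> v)"

definition perp :: "'a::euclidean_space \<Rightarrow> 'a set" where
  "perp \<nu> = {x. x \<bullet> \<nu> = 0}"

definition slice :: "'a::euclidean_space set \<Rightarrow> 'a \<Rightarrow> real \<Rightarrow> 'a set" where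
  "slice K \<nu> p = K \<inter> {x. x \<bullet> \<nu> = p}"

text \<open>
  The supremum is taken in \<^typ>\<open>ereal\<close>, where the supremum of the empty set is \<open>-\<infinity>\<close>; this is
  the convention for empty slices. Only the values at \<^term>\<open>u \<in> perp \<nu>\<close> play a role.
\<close>

definition slicing_support_fun ::
  "'a::euclidean_space set \<Rightarrow> 'a \<Rightarrow> 'a \<Rightarrow> real \<Rightarrow> ereal" where
  "slicing_support_fun K \<nu> u p = (SUP x\<in>slice K \<nu> p. ereal (x \<bullet> u))"

lemma slicing_support_fun_empty:
  "slice K \<nu> p = {} \<Longrightarrow> slicing_support_fun K \<nu> u p = -\<infinity>"
  by (simp add: slicing_support_fun_def bot_ereal_def)

end

theory Submission
  imports Defs
begin

text \<open>The hyperplanes orthogonal to \<open>\<nu>\<close> cut \<open>K\<close> into disjoint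
  slices, one for each value p of \<open>x \<bullet> \<nu>\<close>. On the slice at height p the
  functional \<open>x \<bullet> (u + l *\<^sub>R \<nu>)\<close> equals
  \<open>x \<bullet> u + l * p\<close>, so its second term is constant there. The supremum over
  \<open>K\<close> is thus an iterated supremum: first over each slice, then over p; empty slices
  contribute -\<infinity> and are harmless. This is
  \<open>support_fun_eq_SUP_slicing_support_fun\<close>. Splitting v into its parts orthogonal and
  parallel to \<open>\<nu>\<close> gives the formula for every v, and that formula reads the slicing
  data only on \<open>perp \<nu>\<close>, so these data determine the support function.\<close>

text \<open>Bridges the real-valued \<open>support_fun\<close> and the \<open>ereal\<close>-valued
  suprema over slices. Compactness bounds the values \<open>x \<bullet> v\<close>, so the real
  supremum is a genuine one.\<close>

lemma ereal_support_fun: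
  fixes K :: "'a::euclidean_space set"
  assumes "convex_body K"
  shows "ereal (support_fun K v) = (SUP x\<in>K. ereal (x \<bullet> v))"
proof -
  have ne: "K \<noteq> {}" and "compact K"
    using assms by (auto simp: convex_body_def)
  then have "compact ((\<lambda>x. x \<bullet> v) ` K)"
    by (intro compact_continuous_image continuous_intros)
  then have bdd: "bdd_above ((\<lambda>x. x \<bullet> v) ` K)"
    by (intro bounded_imp_bdd_above compact_imp_bounded)
  show ?thesis
  proof (rule antisym)
    show "(SUP x\<in>K. ereal (x \<bullet> v)) \<le> ereal (support_fun K v)"
      unfolding support_fun_def by (rule SUP_least) (simp add: cSUP_upper[OF _ bdd])
    show "ereal (support_fun K v) \<le> (SUP x\<in>K. ereal (x \<bullet> v))"
    \<comment> \<open>Comparing against real upper bounds z avoids showing first that the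
      \<open>ereal\<close> supremum is finite.\<close>
    proof (rule ereal_le_real)
      fix z assume z: "(SUP x\<in>K. ereal (x \<bullet> v)) \<le> ereal z"
      have "x \<bullet> v \<le> z" if "x \<in> K" for x
        using SUP_upper[OF that, of "\<lambda>x. ereal (x \<bullet> v)"] z by (metis ereal_less_eq(3) order_trans)
      then show "ereal (support_fun K v) \<le> ereal z"
        unfolding support_fun_def using ne by (simp add: cSUP_least)
    qed
  qed
qed

lemma support_fun_eq_SUP_slicing_support_fun:
  fixes K :: "'a::euclidean_space set"
  assumes "convex_body K"
  shows "ereal (support_fun K (u + l *\<^sub>R \<nu>)) =
    (SUP p::real. slicing_support_fun K \<nu> u p + ereal (l * p))"
  unfolding ereal_support_fun[OF assms]
proof (rule antisym)
  show "(SUP x\<in>K. ereal (x \<bullet> (u + l *\<^sub>R \<nu>)))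
      \<le> (SUP p::real. slicing_support_fun K \<nu> u p + ereal (l * p))"
  proof (rule SUP_least)
    fix x assume x: "x \<in> K"
    \<comment> \<open>The height \<open>x \<bullet> \<nu>\<close> selects the slice that contains
      x.\<close>
    have "ereal (x \<bullet> u) \<le> slicing_support_fun K \<nu> u (x \<bullet> \<nu>)"
      unfolding slicing_support_fun_def by (rule SUP_upper) (simp add: slice_def x)
    then have "ereal (x \<bullet> u) + ereal (l * (x \<bullet> \<nu>))
        \<le> slicing_support_fun K \<nu> u (x \<bullet> \<nu>) + ereal (l * (x \<bullet> \<nu>))"
      by (rule add_right_mono)
    also have "\<dots> \<le> (SUP p::real. slicing_support_fun K \<nu> u p + ereal (l * p))"
      by (rule SUP_upper) simp
    finally show "ereal (x \<bullet> (u + l *\<^sub>R \<nu>))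
        \<le> (SUP p::real. slicing_support_fun K \<nu> u p + ereal (l * p))"
      by (simp add: inner_add_right)
  qed
  show "(SUP p::real. slicing_support_fun K \<nu> u p + ereal (l * p))
      \<le> (SUP x\<in>K. ereal (x \<bullet> (u + l *\<^sub>R \<nu>)))" (is "_ \<le> ?S")
  proof (rule SUP_least)
    fix p :: real
    \<comment> \<open>The finite term \<open>l * p\<close> is moved across so that the left side is
      a bare supremum over the slice; \<open>SUP_least\<close> then covers empty slices too.\<close>
    have "slicing_support_fun K \<nu> u p \<le> ?S - ereal (l * p)"
      unfolding slicing_support_fun_def
    proof (rule SUP_least)
      fix x assume "x \<in> slice K \<nu> p"
      then have x: "x \<in> K" and p: "x \<bullet> \<nu> = p"
        by (auto simp: slice_def)
      have "ereal (x \<bullet> u) + ereal (l * p) \<le> ?S"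
        using SUP_upper[OF x, of "\<lambda>x. ereal (x \<bullet> (u + l *\<^sub>R \<nu>))"] p
        by (simp add: inner_add_right)
      then show "ereal (x \<bullet> u) \<le> ?S - ereal (l * p)"
        by (simp add: ereal_le_minus)
    qed
    then show "slicing_support_fun K \<nu> u p + ereal (l * p) \<le> ?S"
      by (simp add: ereal_le_minus)
  qed
qed

text \<open>The vectors \<open>v - (v \<bullet> \<nu>) *\<^sub>R \<nu>\<close> and
  \<open>(v \<bullet> \<nu>) *\<^sub>R \<nu>\<close> add up to v, so this is an instance of the
  previous formula.\<close>

lemma support_fun_eq_SUP_slicing_support_fun_proj:
  fixes K :: "'a::euclidean_space set"
  assumes "convex_body K"
  shows "ereal (support_fun K v) =
    (SUP p::real. slicing_support_fun K \<nu> (v - (v \<bullet> \<nu>) *\<^sub>R \<nu>) p + ereal ((v \<bullet> \<nu>) * p))"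
  using support_fun_eq_SUP_slicing_support_fun[OF assms, of "v - (v \<bullet> \<nu>) *\<^sub>R \<nu>" "v \<bullet> \<nu>" \<nu>]
  by simp

text \<open>Since \<open>\<nu> \<bullet> \<nu> = 1\<close>, subtracting the component along
  \<open>\<nu>\<close> leaves an orthogonal vector, a point where the slicing data are
  given.\<close>

lemma diff_proj_in_perp:
  assumes "\<nu> \<in> sphere 0 1"
  shows "v - (v \<bullet> \<nu>) *\<^sub>R \<nu> \<in> perp \<nu>"
  using assms by (simp add: perp_def inner_diff_left norm_eq_1)

theorem theorem1:
  fixes K :: "(real ^ 'n) set" and \<nu> :: "real ^ 'n"
  assumes "convex_body K" and "\<nu> \<in> sphere 0 1"
  shows "(\<forall>u \<in> perp \<nu>. \<forall>l::real.
            ereal (support_fun K (u + l *\<^sub>R \<nu>)) =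
              (SUP p::real. slicing_support_fun K \<nu> u p + ereal (l * p)))
       \<and> (\<forall>L :: (real ^ 'n) set. convex_body L \<longrightarrow>
            (\<forall>u \<in> perp \<nu>. \<forall>p::real. slicing_support_fun K \<nu> u p = slicing_support_fun L \<nu> u p) \<longrightarrow>
            (\<forall>v. support_fun K v = support_fun L v))
       \<and> (\<forall>v. ereal (support_fun K v) =
              (SUP p::real. slicing_support_fun K \<nu> (v - (v \<bullet> \<nu>) *\<^sub>R \<nu>) p + ereal ((v \<bullet> \<nu>) * p)))"
proof (intro conjI ballI allI impI)
  fix L :: "(real ^ 'n) set" and v
  assume L: "convex_body L"
    and eq: "\<forall>u \<in> perp \<nu>. \<forall>p::real. slicing_support_fun K \<nu> u p = slicing_support_fun L \<nu> u p"
  \<comment> \<open>Both sides become the same supremum over p, since the slicing functions of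
    \<open>K\<close> and \<open>L\<close> agree at the orthogonal part of v.\<close>
  have "ereal (support_fun K v) = ereal (support_fun L v)"
    unfolding support_fun_eq_SUP_slicing_support_fun_proj[OF assms(1), of _ \<nu>]
      support_fun_eq_SUP_slicing_support_fun_proj[OF L, of _ \<nu>]
    using eq diff_proj_in_perp[OF assms(2)] by simp
  then show "support_fun K v = support_fun L v"
    by simp
qed (rule support_fun_eq_SUP_slicing_support_fun[OF assms(1)]
  support_fun_eq_SUP_slicing_support_fun_proj[OF assms(1)])+

end
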